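(* Let $Q\in O(2)$ be arbitrary and let $P\in\mathbb R^{6\times6}$ be the block-diagonal matrix $$P=\begin{pmatrix}Q&0&0&0\\0&1&0&0\\0&0&\det(Q)Q&0\\0&0&0&1\end{pmatrix}$$ (blocks of sizes $2,1,2,1$). Then the exponential map has the symmetry property $$\widetilde{Exp}_e(\boldsymbol\lambda(0)P^T,l)=\Big(\mathbf 0,\begin{pmatrix}Q&0\\0&1\end{pmatrix}\Big)\cdot\widetilde{Exp}_e(\boldsymbol\lambda(0),l)\cdot\Big(\mathbf 0,\begin{pmatrix}Q^T&0\\0&1\end{pmatrix}\Big)$$ for initial momenta $\boldsymbol\lambda(0)=(\lambda_1(0),\dots,\lambda_6(0))$ with $\lambda_6(0)=0$. Here the group product $\cdot$ is that of the Euclidean group $E(3)$.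
   Context: Throughout $\xi=1$. $E(3)=\mathbb R^3\rtimes O(3)$ and $SE(3)=\mathbb R^3\rtimes SO(3)$ with product $(\mathbf x_1,R_1)\cdot(\mathbf x_2,R_2)=(\mathbf x_1+R_1\mathbf x_2,R_1R_2)$, $e=(\mathbf 0,I)$. For $\mathbf a\in\mathbb R^3$, $\sigma_{\mathbf a}\mathbf y=\mathbf a\times\mathbf y$. Left-invariant frame: $\mathcal A_i|_{(\mathbf x,R)}=(R\mathbf e_i,0)$, $\mathcal A_{3+i}|_{(\mathbf x,R)}=(0,R\sigma_{\mathbf e_i})$, $i=1,2,3$. The momentum is written as a row vector $\boldsymbol\lambda=(\lambda_1,\dots,\lambda_6)$ of components with respect to the dual coframe. $\widetilde{Exp}_e(\boldsymbol\lambda(0),l)\in SE(3)$ is the end point $\gamma(l)$ at time $l\geq 0$ of the solution of the Hamiltonian system $\dot\gamma=\lambda_3\mathcal A_3+\lambda_4\mathcal A_4+\lambda_5\mathcal A_5$, $\dot\lambda_1=-\lambda_3\lambda_5$, $\dot\lambda_2=\lambda_3\lambda_4$, $\dot\lambda_3=\lambda_1\lambda_5-\lambda_2\lambda_4$, $\dot\lambda_4=\lambda_2\lambda_3-\lambda_5\lambda_6$, $\dot\lambda_5=\lambda_4\lambda_6-\lambda_1\lambda_3$, $\dot\lambda_6=0$, with $\gamma(0)=e$, initial momentum $\boldsymbol\lambda(0)$ and $\lambda_3(0)^2+\lambda_4(0)^2+\lambda_5(0)^2=1$. *)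

theory Defs
  imports "HOL-Analysis.Analysis" "HOL-Algebra.Group"
begin

definition E3 :: "((real^3) \<times> (real^3^3)) monoid" where
  "E3 = \<lparr>carrier = UNIV \<times> {R. orthogonal_matrix R},
         mult = (\<lambda>(x1, R1) (x2, R2). (x1 + R1 *v x2, R1 ** R2)),
         one = (0, mat 1)\<rparr>"

definition SE3 :: "((real^3) \<times> (real^3^3)) set" where
  "SE3 = UNIV \<times> {R. rotation_matrix R}"

lemma group_E3: "group E3"
proof (rule groupI)
  fix x assume "x \<in> carrier E3"
  then show "\<exists>y\<in>carrier E3. y \<otimes>\<^bsub>E3\<^esub> x = \<one>\<^bsub>E3\<^esub>"
    by (intro bexI[of _ "(- (transpose (snd x) *v fst x), transpose (snd x))"])
       (auto simp: E3_def orthogonal_matrix_def)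
qed (auto simp: E3_def orthogonal_matrix_mul orthogonal_matrix_id matrix_mul_assoc
       matrix_vector_mul_assoc matrix_vector_right_distrib)

lemma subgroup_SE3: "subgroup SE3 E3"
proof -
  interpret group E3 by (rule group_E3)
  show ?thesis
  proof (rule subgroupI)
    fix a assume a: "a \<in> SE3"
    have "inv\<^bsub>E3\<^esub> a = (- (transpose (snd a) *v fst a), transpose (snd a))"
      using a by (intro inv_equality)
        (auto simp: E3_def SE3_def rotation_matrix_def orthogonal_matrix_def)
    then show "inv\<^bsub>E3\<^esub> a \<in> SE3"
      using a by (auto simp: SE3_def rotation_matrix_def)
  qed (auto simp: E3_def SE3_def rotation_matrix_def orthogonal_matrix_mul det_mul
         intro: exI[of _ "mat 1"] orthogonal_matrix_id)
qed

definition cross_mat :: "real^3 \<Rightarrow> real^3^3" where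
  "cross_mat a = matrix (cross3 a)"

text \<open>
  The left-invariant frame of six vector fields: for \<open>i = 1, 2, 3\<close> the translational field
  \<open>A_i\<close> is \<open>frame_trans i\<close> and the rotational field \<open>A_(3+i)\<close> is \<open>frame_rot i\<close>.
  Tangent vectors are taken in the ambient space of pairs.
\<close>

definition frame_trans :: "3 \<Rightarrow> (real^3) \<times> (real^3^3) \<Rightarrow> (real^3) \<times> (real^3^3)" where
  "frame_trans i = (\<lambda>(x, R). (R *v axis i 1, 0))"

definition frame_rot :: "3 \<Rightarrow> (real^3) \<times> (real^3^3) \<Rightarrow> (real^3) \<times> (real^3^3)" where
  "frame_rot i = (\<lambda>(x, R). (0, R ** cross_mat (axis i 1)))"

text \<open>
  Solutions on \<open>[0, l]\<close>; derivatives are one-sided at the end points. The index type \<open>6\<close>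
  consists of the residues modulo 6, so \<open>p t $ 6\<close> is the sixth component.
\<close>

definition hamiltonian_solution ::
    "real \<Rightarrow> (real \<Rightarrow> (real^3) \<times> (real^3^3)) \<Rightarrow> (real \<Rightarrow> real^6) \<Rightarrow> bool" where
  "hamiltonian_solution l \<gamma> p \<longleftrightarrow> (\<forall>t\<in>{0..l}.
     \<gamma> t \<in> SE3 \<and>
     (\<gamma> has_vector_derivative
        p t $ 3 *\<^sub>R frame_trans 3 (\<gamma> t) + p t $ 4 *\<^sub>R frame_rot 1 (\<gamma> t)
          + p t $ 5 *\<^sub>R frame_rot 2 (\<gamma> t)) (at t within {0..l}) \<and>
     ((\<lambda>s. p s $ 1) has_real_derivative - (p t $ 3 * p t $ 5)) (at t within {0..l}) \<and>
     ((\<lambda>s. p s $ 2) has_real_derivative p t $ 3 * p t $ 4) (at t within {0..l}) \<and>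
     ((\<lambda>s. p s $ 3) has_real_derivative p t $ 1 * p t $ 5 - p t $ 2 * p t $ 4) (at t within {0..l}) \<and>
     ((\<lambda>s. p s $ 4) has_real_derivative p t $ 2 * p t $ 3 - p t $ 5 * p t $ 6) (at t within {0..l}) \<and>
     ((\<lambda>s. p s $ 5) has_real_derivative p t $ 4 * p t $ 6 - p t $ 1 * p t $ 3) (at t within {0..l}) \<and>
     ((\<lambda>s. p s $ 6) has_real_derivative 0) (at t within {0..l}))"

text \<open>
  The exponential map is meant for \<open>l \<ge> 0\<close> and momenta on the cylinder
  \<open>p0$3^2 + p0$4^2 + p0$5^2 = 1\<close>, where solutions with these initial data exist on every
  interval \<open>[0, l]\<close> and are unique; where no end point is determined, it is unspecified.
\<close>

definition exp_e :: "real^6 \<Rightarrow> real \<Rightarrow> (real^3) \<times> (real^3^3)" where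
  "exp_e p0 l = (THE g. \<exists>\<gamma> p. hamiltonian_solution l \<gamma> p \<and>
     \<gamma> 0 = \<one>\<^bsub>E3\<^esub> \<and> p 0 = p0 \<and> \<gamma> l = g)"

definition hat :: "real^2^2 \<Rightarrow> real^3^3" where
  "hat Q = vector
    [vector [Q$1$1, Q$1$2, 0],
     vector [Q$2$1, Q$2$2, 0],
     vector [0,     0,     1]]"

definition momentum_matrix :: "real^2^2 \<Rightarrow> real^6^6" where
  "momentum_matrix Q = vector
    [vector [Q$1$1, Q$1$2, 0, 0,              0,              0],
     vector [Q$2$1, Q$2$2, 0, 0,              0,              0],
     vector [0,     0,     1, 0,              0,              0],
     vector [0,     0,     0, det Q * Q$1$1,  det Q * Q$1$2,  0],
     vector [0,     0,     0, det Q * Q$2$1,  det Q * Q$2$2,  0],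
     vector [0,     0,     0, 0,              0,              1]]"

end

theory Submission imports Defs begin

text \<open>
  Conjugation by \<open>(0, hat Q)\<close> together with the momentum matrix maps solutions of the Hamiltonian
  system with vanishing sixth momentum to solutions: a cross product picks up a factor \<open>det Q\<close>
  under \<open>hat Q\<close>, which the third block of the momentum matrix compensates, and only the terms
  containing the sixth momentum would get the wrong sign when \<open>det Q = -1\<close>.
  To pass from solutions to \<open>exp_e\<close>, a definite description, solutions on \<open>[0, l]\<close> must exist
  and be unique. Momentum and rotation together satisfy a homogeneous quadratic equation
  \<open>y' = B y y\<close>, and the squared norm plus the square of the third momentum is a first integral
  of it, so that solutions cannot blow up. The position is then an integral.
\<close>

section \<open>Existence and uniqueness for quadratic differential equations\<close>

text \<open>Picard iteration for the weighted unknown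
  \<open>u t = exp (- (2 * L * t)) *\<^sub>R y t\<close>. In the sup norm of \<open>u\<close> the
  integral operator contracts by 1/2 on the whole interval, however long, so no local solutions need
  gluing.\<close>

lemma lipschitz_ode_exists:
  fixes g :: "'a::banach \<Rightarrow> 'a" and l :: real
  assumes L: "L > 0" and lip: "\<And>x y. norm (g x - g y) \<le> L * norm (x - y)" and l: "0 \<le> l"
  obtains y where "y 0 = y0"
    "\<And>t. t \<in> {0..l} \<Longrightarrow> (y has_vector_derivative g (y t)) (at t within {0..l})"
proof -
  have cont_g: "continuous_on UNIV g"
  proof (rule lipschitz_on_continuous_on)
    show "L-lipschitz_on UNIV g"
      using L lip by (auto intro!: lipschitz_onI simp: dist_norm)
  qed
  \<comment> \<open>Clamping time to \<open>{0..l}\<close> extends the functions to all reals, as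
    the type of bounded continuous functions requires.\<close>
  define c where "c t = max 0 (min t l)" for t :: real
  have c: "0 \<le> c t" "c t \<le> l" for t using l by (auto simp: c_def)
  have c_id: "c t = t" if "t \<in> {0..l}" for t using that by (auto simp: c_def)
  define G where "G u s = g (exp (2 * L * s) *\<^sub>R apply_bcontfun u s)" for u s
  have cont_G: "continuous_on S (G u)" for S u
    unfolding G_def by (intro continuous_on_compose2[OF cont_g] continuous_intros) auto
  have int_G: "G u integrable_on {0..t}" for u t
    by (rule integrable_continuous_real[OF cont_G])
  define F where "F u t = exp (- (2 * L * c t)) *\<^sub>R (y0 + integral {0..c t} (G u))" for u t
  have F_bcont: "F u \<in> bcontfun" for u
  proof -
    define H where "H t = exp (- (2 * L * t)) *\<^sub>R (y0 + integral {0..t} (G u))" for t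
    have H: "continuous_on {0..l} H"
      unfolding H_def by (intro continuous_intros indefinite_integral_continuous_1 int_G)
    have F: "F u = H \<circ> c" by (auto simp: F_def H_def)
    have "continuous_on UNIV (F u)" unfolding F
    proof (rule continuous_on_compose)
      show "continuous_on UNIV c" unfolding c_def by (intro continuous_intros)
      show "continuous_on (range c) H" by (rule continuous_on_subset[OF H]) (use c in auto)
    qed
    moreover have "bounded (H ` {0..l})"
      by (intro compact_imp_bounded compact_continuous_image H) simp
    then have "bounded (range (F u))"
      unfolding F by (rule bounded_subset) (use c in auto)
    ultimately show ?thesis by (simp add: bcontfun_def)
  qed
  define \<Phi> where "\<Phi> u = Bcontfun (F u)" for u
  have \<Phi>: "apply_bcontfun (\<Phi> u) = F u" for u
    unfolding \<Phi>_def by (rule Bcontfun_inverse[OF F_bcont])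
  have "dist (\<Phi> u) (\<Phi> v) \<le> 1/2 * dist u v" for u v
  proof (rule dist_bound)
    fix t
    let ?e = "exp (2 * L * c t)"
    \<comment> \<open>The weight 2L yields the contraction factor: integrating
      \<open>L * exp (2 * L * s)\<close> leaves at most half of the weight at the end point.\<close>
    have *: "((\<lambda>s. L * (exp (2 * L * s) * dist u v)) has_integral
        (exp (2 * L * c t) * dist u v / 2 - exp (2 * L * 0) * dist u v / 2)) {0..c t}"
      using c L by (intro fundamental_theorem_of_calculus)
        (auto intro!: derivative_eq_intros simp flip: has_real_derivative_iff_has_vector_derivative)
    have "norm (integral {0..c t} (\<lambda>s. G u s - G v s))
        \<le> integral {0..c t} (\<lambda>s. L * (exp (2 * L * s) * dist u v))"
    proof (rule integral_norm_bound_integral)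
      fix s
      have "norm (G u s - G v s) \<le> L * (exp (2 * L * s) * dist (u s) (v s))"
        using lip[of "exp (2 * L * s) *\<^sub>R u s" "exp (2 * L * s) *\<^sub>R v s"]
        by (simp add: G_def dist_norm flip: scaleR_right_diff_distrib)
      also have "\<dots> \<le> L * (exp (2 * L * s) * dist u v)"
        using L by (intro mult_left_mono dist_bounded) auto
      finally show "norm (G u s - G v s) \<le> L * (exp (2 * L * s) * dist u v)" .
    qed (use * in \<open>auto intro!: integrable_diff int_G\<close>)
    also have "\<dots> = (?e - 1) * dist u v / 2"
      using integral_unique[OF *] by (simp add: algebra_simps diff_divide_distrib)
    also have "\<dots> \<le> ?e * dist u v / 2" by (simp add: mult_right_mono)
    finally have I: "norm (integral {0..c t} (G u) - integral {0..c t} (G v)) \<le> ?e * dist u v / 2"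
      by (simp add: integral_diff int_G)
    have "dist (F u t) (F v t)
        = exp (- (2 * L * c t)) * norm (integral {0..c t} (G u) - integral {0..c t} (G v))"
      by (simp add: F_def dist_norm flip: scaleR_right_diff_distrib)
    also have "\<dots> \<le> exp (- (2 * L * c t)) * (?e * dist u v / 2)"
      by (intro mult_left_mono I) auto
    also have "\<dots> = 1/2 * dist u v" by (simp add: exp_minus field_simps)
    finally show "dist (\<Phi> u t) (\<Phi> v t) \<le> 1/2 * dist u v" by (simp add: \<Phi>)
  qed
  then obtain u where u: "\<Phi> u = u"
    using banach_fix_type[of "1/2" \<Phi>] by auto
  define y where "y t = y0 + integral {0..t} (G u)" for t
  have y: "y t = exp (2 * L * t) *\<^sub>R u t" if "t \<in> {0..l}" for t
    using fun_cong[OF \<Phi>[of u], of t] that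
    by (simp add: u F_def c_id y_def flip: exp_add)
  show thesis
  proof
    show "y 0 = y0" by (simp add: y_def)
    fix t assume t: "t \<in> {0..l}"
    have "(y has_vector_derivative G u t) (at t within {0..l})"
      unfolding y_def using t by (auto intro!: derivative_eq_intros integral_has_vector_derivative cont_G)
    then show "(y has_vector_derivative g (y t)) (at t within {0..l})"
      using t by (simp add: G_def y)
  qed
qed

text \<open>\<open>B x x - B y y\<close> splits as \<open>B x (x - y) + B (x - y) y\<close>, and
  each term is linear in the difference.\<close>

lemma bounded_bilinear_diag_lipschitz:
  fixes B :: "'a::real_normed_vector \<Rightarrow> 'a \<Rightarrow> 'b::real_normed_vector"
  assumes "bounded_bilinear B" and "0 \<le> r"
  obtains K where "K > 0"
    "\<And>x y. norm x \<le> r \<Longrightarrow> norm y \<le> r \<Longrightarrow> norm (B x x - B y y) \<le> K * norm (x - y)"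
proof -
  interpret B: bounded_bilinear B by fact
  obtain C where C: "C > 0" "\<And>a b. norm (B a b) \<le> norm a * norm b * C"
    using B.pos_bounded by blast
  show thesis
  proof
    \<comment> \<open>The summand 1 keeps the constant positive even for
      \<open>r = 0\<close>.\<close>
    show "2 * r * C + 1 > 0" using C assms(2) by (simp add: add_nonneg_pos)
    fix x y :: 'a assume xy: "norm x \<le> r" "norm y \<le> r"
    have "B x x - B y y = B x (x - y) + B (x - y) y"
      by (simp add: B.diff_left B.diff_right)
    then have "norm (B x x - B y y) \<le> norm (B x (x - y)) + norm (B (x - y) y)"
      by (metis norm_triangle_ineq)
    also have "\<dots> \<le> norm x * norm (x - y) * C + norm (x - y) * norm y * C"
      by (intro add_mono C)
    also have "\<dots> \<le> r * norm (x - y) * C + norm (x - y) * r * C"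
      using xy C(1) by (intro add_mono mult_right_mono mult_left_mono) auto
    also have "\<dots> \<le> (2 * r * C + 1) * norm (x - y)"
      by (simp add: algebra_simps)
    finally show "norm (B x x - B y y) \<le> (2 * r * C + 1) * norm (x - y)" .
  qed
qed

text \<open>The projection is radial, by the reverse triangle inequality. The value of the factor is
  left open because proportionality is all that a homogeneity argument needs.\<close>

lemma closest_point_cball_0:
  fixes y :: "'a::euclidean_space"
  assumes "0 \<le> r"
  obtains a where "closest_point (cball 0 r) y = a *\<^sub>R y"
proof (cases "norm y \<le> r")
  case True
  then show ?thesis by (intro that[of 1]) (simp add: closest_point_self)
next
  case False
  have "(r / norm y) *\<^sub>R y = closest_point (cball 0 r) y"
  proof (rule closest_point_unique)
    show "\<forall>z\<in>cball 0 r. dist y ((r / norm y) *\<^sub>R y) \<le> dist y z"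
    proof
      fix z :: 'a assume z: "z \<in> cball 0 r"
      have "y - (r / norm y) *\<^sub>R y = (1 - r / norm y) *\<^sub>R y" by (simp add: scaleR_left_diff_distrib)
      then have "dist y ((r / norm y) *\<^sub>R y) = \<bar>1 - r / norm y\<bar> * norm y"
        by (simp add: dist_norm)
      also have "\<dots> = norm y - r"
        using False assms by (auto simp: abs_if field_simps)
      also have "\<dots> \<le> dist y z"
        using z norm_triangle_ineq2[of y z] by (simp add: dist_norm)
      finally show "dist y ((r / norm y) *\<^sub>R y) \<le> dist y z" .
    qed
  qed (use assms False in auto)
  then show ?thesis using that by metis
qed

text \<open>
  Replacing \<open>y\<close> by its projection to a large ball makes the field globally Lipschitz; by
  homogeneity this only rescales the field by a scalar factor, so that \<open>W\<close> stays a first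
  integral and confines the solution to the ball on which nothing was changed.
\<close>

lemma quadratic_ode_exists:
  fixes B :: "'a::euclidean_space \<Rightarrow> 'a \<Rightarrow> 'a" and l :: real
  assumes B: "bounded_bilinear B" and l: "0 \<le> l"
    and W: "\<And>y. (W has_derivative W' y) (at y)"
    and W0: "\<And>y. W' y (B y y) = 0"
    and W1: "\<And>y. (norm y)\<^sup>2 \<le> W y"
  obtains y where "y 0 = y0"
    "\<And>t. t \<in> {0..l} \<Longrightarrow> (y has_vector_derivative B (y t) (y t)) (at t within {0..l})"
proof -
  interpret B: bounded_bilinear B by fact
  \<comment> \<open>\<open>W\<close> is constant along solutions and dominates the squared norm, so
    this radius is never exceeded.\<close>
  define r where "r = sqrt (W y0)"
  have "0 \<le> W y0" by (rule order_trans[OF _ W1]) simp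
  then have r: "0 \<le> r" "r\<^sup>2 = W y0" by (simp_all add: r_def)
  obtain K where K: "K > 0"
    "\<And>x y. norm x \<le> r \<Longrightarrow> norm y \<le> r \<Longrightarrow> norm (B x x - B y y) \<le> K * norm (x - y)"
    using bounded_bilinear_diag_lipschitz[OF B r(1)] by blast
  define \<pi> where "\<pi> = closest_point (cball (0::'a) r)"
  have \<pi>r: "norm (\<pi> x) \<le> r" for x
    using closest_point_in_set[of "cball (0::'a) r" x] r by (auto simp: \<pi>_def)
  have lip: "norm (B (\<pi> x) (\<pi> x) - B (\<pi> y) (\<pi> y)) \<le> K * norm (x - y)" for x y
  proof -
    have "norm (\<pi> x - \<pi> y) \<le> norm (x - y)"
      using closest_point_lipschitz[of "cball (0::'a) r" x y] r by (simp add: \<pi>_def dist_norm)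
    then have "K * norm (\<pi> x - \<pi> y) \<le> K * norm (x - y)" using K(1) by simp
    then show ?thesis using K(2)[OF \<pi>r \<pi>r] by (rule order_trans[rotated])
  qed
  obtain y where y: "y 0 = y0"
    "\<And>t. t \<in> {0..l} \<Longrightarrow> (y has_vector_derivative B (\<pi> (y t)) (\<pi> (y t))) (at t within {0..l})"
    using lipschitz_ode_exists[OF K(1) lip l] by metis
  have dW: "((\<lambda>t. W (y t)) has_vector_derivative 0) (at t within {0..l})" if t: "t \<in> {0..l}" for t
  proof -
    obtain a where a: "\<pi> (y t) = a *\<^sub>R y t"
      using closest_point_cball_0[OF r(1), of "y t"] by (auto simp: \<pi>_def)
    interpret W': bounded_linear "W' (y t)" by (rule has_derivative_bounded_linear[OF W])
    have "W' (y t) (B (\<pi> (y t)) (\<pi> (y t))) = 0"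
      by (simp add: a B.scaleR_left B.scaleR_right W'.scaleR W0)
    then show ?thesis
      using vector_derivative_diff_chain_within[OF y(2)[OF t] has_derivative_at_withinI[OF W]]
      by (simp add: o_def)
  qed
  have "\<pi> (y t) = y t" if t: "t \<in> {0..l}" for t
  proof -
    obtain k where k: "\<And>s. s \<in> {0..l} \<Longrightarrow> W (y s) = k"
      using has_vector_derivative_zero_constant[of "{0..l}" "\<lambda>t. W (y t)"] dW by auto
    have "W (y t) = r\<^sup>2" using k[OF t] k[of 0] l y(1) r by simp
    then have "norm (y t) \<le> r" using W1[of "y t"] r power2_le_imp_le by metis
    then show ?thesis by (simp add: \<pi>_def closest_point_self)
  qed
  then show thesis using that y by metis
qed

text \<open>Gronwall's argument. Both trajectories are compact, hence lie in a common ball on which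
  the field has a Lipschitz constant \<open>K\<close>; then the squared distance multiplied by
  \<open>exp (- (2 * K * s))\<close> cannot increase from 0.\<close>

lemma quadratic_ode_unique:
  fixes B :: "'a::real_inner \<Rightarrow> 'a \<Rightarrow> 'a" and l :: real
  assumes B: "bounded_bilinear B"
    and y: "\<And>t. t \<in> {0..l} \<Longrightarrow> (y has_vector_derivative B (y t) (y t)) (at t within {0..l})"
    and z: "\<And>t. t \<in> {0..l} \<Longrightarrow> (z has_vector_derivative B (z t) (z t)) (at t within {0..l})"
    and init: "y 0 = z 0" and t: "t \<in> {0..l}"
  shows "y t = z t"
proof -
  have "continuous_on {0..l} y" "continuous_on {0..l} z"
    by (rule continuous_on_vector_derivative, erule y z)+
  then have "bounded (y ` {0..l} \<union> z ` {0..l})"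
    by (auto intro!: compact_imp_bounded compact_continuous_image)
  then obtain r where r: "\<And>s. s \<in> {0..l} \<Longrightarrow> norm (y s) \<le> r \<and> norm (z s) \<le> r"
    unfolding bounded_iff by blast
  have "0 \<le> r" using r[OF t] norm_ge_zero order_trans by blast
  then obtain K where K: "\<And>a b. norm a \<le> r \<Longrightarrow> norm b \<le> r \<Longrightarrow>
      norm (B a a - B b b) \<le> K * norm (a - b)"
    using bounded_bilinear_diag_lipschitz[OF B] by metis
  define h where "h s = exp (- (2 * K * s)) * inner (y s - z s) (y s - z s)" for s
  have "h t \<le> h 0"
  proof (rule DERIV_nonpos_imp_decreasing_open[where f = h])
    have "continuous_on {0..l} h"
      unfolding h_def by (intro continuous_intros \<open>continuous_on {0..l} y\<close> \<open>continuous_on {0..l} z\<close>)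
    then show "continuous_on {0..t} h" by (rule continuous_on_subset) (use t in auto)
    fix s assume s: "0 < s" "s < t"
    then have sl: "s \<in> {0..l}" and at: "at s within {0..l} = at s"
      using t by (auto intro: at_within_Icc_at)
    have dy: "(y has_vector_derivative B (y s) (y s)) (at s)"
      and dz: "(z has_vector_derivative B (z s) (z s)) (at s)" using y[OF sl] z[OF sl] by (simp_all add: at)
    let ?d = "y s - z s"
    let ?b = "B (y s) (y s) - B (z s) (z s)"
    have d: "((\<lambda>s. y s - z s) has_vector_derivative ?b) (at s)"
      by (rule has_vector_derivative_diff[OF dy dz])
    have "((\<lambda>s. inner (y s - z s) (y s - z s)) has_vector_derivative inner ?d ?b + inner ?b ?d) (at s)"
      by (rule bounded_bilinear.has_vector_derivative[OF bounded_bilinear_inner d d])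
    then have dn: "((\<lambda>s. inner (y s - z s) (y s - z s)) has_real_derivative 2 * inner ?d ?b) (at s)"
      by (simp add: has_real_derivative_iff_has_vector_derivative inner_commute)
    have dh: "(h has_real_derivative
        exp (- (2 * K * s)) * (2 * (inner ?d ?b - K * inner ?d ?d))) (at s)"
    proof -
      have "((\<lambda>s. exp (- (2 * K * s))) has_real_derivative - (2 * K) * exp (- (2 * K * s))) (at s)"
        by (auto intro!: derivative_eq_intros)
      from DERIV_mult[OF this dn] show ?thesis
        unfolding h_def by (simp add: algebra_simps)
    qed
    have "inner ?d ?b \<le> norm ?d * norm ?b" by (rule norm_cauchy_schwarz)
    also have "\<dots> \<le> norm ?d * (K * norm ?d)"
      using r[OF sl] by (intro mult_left_mono K) auto
    also have "\<dots> = K * inner ?d ?d"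
      by (simp add: dot_square_norm power2_eq_square)
    finally have "exp (- (2 * K * s)) * (2 * (inner ?d ?b - K * inner ?d ?d)) \<le> 0"
      by (intro mult_nonneg_nonpos) simp_all
    with dh show "\<exists>d. (h has_real_derivative d) (at s) \<and> d \<le> 0" by blast
  qed (use t in auto)
  then have "inner (y t - z t) (y t - z t) \<le> 0"
    using init by (simp add: h_def mult_le_0_iff)
  then show ?thesis by (metis inner_gt_zero_iff linorder_not_le eq_iff_diff_eq_0)
qed

section \<open>Coordinates and componentwise derivatives\<close>

lemma exhaust_6:
  fixes x :: 6
  shows "x = 1 \<or> x = 2 \<or> x = 3 \<or> x = 4 \<or> x = 5 \<or> x = 6"
proof (induct x)
  case (of_int z)
  then have "z = 0 \<or> z = 1 \<or> z = 2 \<or> z = 3 \<or> z = 4 \<or> z = 5" by fastforce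
  then show ?case by auto
qed

lemma forall_6: "(\<forall>i::6. P i) \<longleftrightarrow> P 1 \<and> P 2 \<and> P 3 \<and> P 4 \<and> P 5 \<and> P 6"
  by (metis exhaust_6)

lemma UNIV_6: "UNIV = {1, 2, 3, 4, 5, 6::6}"
  using exhaust_6 by auto

lemma sum_6: "sum f (UNIV::6 set) = f 1 + f 2 + f 3 + f 4 + f 5 + f 6"
  unfolding UNIV_6 by (simp add: ac_simps)

lemma vector_6 [simp]:
  "(vector [a,b,c,d,e,f] :: ('a::zero)^6)$1 = a"
  "(vector [a,b,c,d,e,f] :: ('a::zero)^6)$2 = b"
  "(vector [a,b,c,d,e,f] :: ('a::zero)^6)$3 = c"
  "(vector [a,b,c,d,e,f] :: ('a::zero)^6)$4 = d"
  "(vector [a,b,c,d,e,f] :: ('a::zero)^6)$5 = e"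
  "(vector [a,b,c,d,e,f] :: ('a::zero)^6)$6 = f"
  unfolding vector_def by simp_all

lemma has_vector_derivative_vec_iff:
  fixes f :: "real \<Rightarrow> real^'n"
  shows "(f has_vector_derivative d) (at t within S) \<longleftrightarrow>
    (\<forall>i. ((\<lambda>s. f s $ i) has_real_derivative d $ i) (at t within S))"
  unfolding has_vector_derivative_def has_derivative_componentwise_within[of f]
  by (auto simp: Basis_vec_def inner_axis has_real_derivative_iff_has_vector_derivative
      has_vector_derivative_def)

lemma has_vector_derivative_Pair_iff:
  "((\<lambda>s. (f s, g s)) has_vector_derivative (a, b)) (at t within S) \<longleftrightarrow>
    (f has_vector_derivative a) (at t within S) \<and> (g has_vector_derivative b) (at t within S)"
proof
  assume *: "((\<lambda>s. (f s, g s)) has_vector_derivative (a, b)) (at t within S)"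
  show "(f has_vector_derivative a) (at t within S) \<and> (g has_vector_derivative b) (at t within S)"
    using bounded_linear.has_vector_derivative[OF bounded_linear_fst *]
      bounded_linear.has_vector_derivative[OF bounded_linear_snd *] by simp
qed (auto intro: has_vector_derivative_Pair)

section \<open>The Hamiltonian system in bilinear form\<close>

lemma cross_mat_eq: "cross_mat a = vector
    [vector [0, - a$3, a$2], vector [a$3, 0, - a$1], vector [- a$2, a$1, 0]]"
  by (simp add: cross_mat_def matrix_def vec_eq_iff forall_3 cross3_simps axis_def)

text \<open>
  A bilinear map whose diagonal is the quadratic right-hand side of the momentum equations; it is
  not symmetrised, only its values at \<open>p = q\<close> matter.
\<close>

definition momentum_field :: "real^6 \<Rightarrow> real^6 \<Rightarrow> real^6" where
  "momentum_field p q = vector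
    [- (p$3 * q$5), p$3 * q$4, p$1 * q$5 - p$2 * q$4,
     p$2 * q$3 - p$5 * q$6, p$4 * q$6 - p$1 * q$3, 0]"

text \<open>The third entry vanishes since the curve has no velocity along the sixth frame field
  \<open>frame_rot 3\<close>.\<close>

definition angular_velocity :: "real^6 \<Rightarrow> real^3" where
  "angular_velocity p = vector [p$4, p$5, 0]"

definition state_field ::
    "(real^6) \<times> (real^3^3) \<Rightarrow> (real^6) \<times> (real^3^3) \<Rightarrow> (real^6) \<times> (real^3^3)" where
  "state_field y z = (momentum_field (fst y) (fst z),
     snd y ** cross_mat (angular_velocity (fst z)))"

lemma bounded_bilinear_state_field: "bounded_bilinear state_field"
proof -
  have "bilinear state_field"
    unfolding bilinear_def
    by (auto intro!: linearI simp: state_field_def momentum_field_def angular_velocity_def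
        cross_mat_eq vec_eq_iff forall_6 forall_3 matrix_matrix_mult_def sum_3 algebra_simps)
  then show ?thesis by (simp add: bilinear_conv_bounded_bilinear)
qed

lemma rotation_velocity_eq:
  "a *\<^sub>R (R ** cross_mat (axis 1 1)) + b *\<^sub>R (R ** cross_mat (axis 2 1))
    = R ** cross_mat (vector [a, b, 0])"
  by (simp add: vec_eq_iff forall_3 cross_mat_eq matrix_matrix_mult_def sum_3 axis_def)

text \<open>Splits off the momentum and rotation, which form a closed quadratic system, from the
  position, which no right-hand side contains.\<close>

lemma hamiltonian_solution_iff:
  "hamiltonian_solution l \<gamma> p \<longleftrightarrow> (\<forall>t\<in>{0..l}.
     rotation_matrix (snd (\<gamma> t)) \<and>
     ((\<lambda>s. (p s, snd (\<gamma> s))) has_vector_derivative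
        state_field (p t, snd (\<gamma> t)) (p t, snd (\<gamma> t))) (at t within {0..l}) \<and>
     ((\<lambda>s. fst (\<gamma> s)) has_vector_derivative
        p t $ 3 *\<^sub>R (snd (\<gamma> t) *v axis 3 1)) (at t within {0..l}))"
proof -
  have vel: "p t $ 3 *\<^sub>R frame_trans 3 (\<gamma> t) + p t $ 4 *\<^sub>R frame_rot 1 (\<gamma> t) + p t $ 5 *\<^sub>R frame_rot 2 (\<gamma> t)
    = (p t $ 3 *\<^sub>R (snd (\<gamma> t) *v axis 3 1), snd (\<gamma> t) ** cross_mat (angular_velocity (p t)))" for t
    by (simp add: frame_trans_def frame_rot_def split_beta angular_velocity_def
        rotation_velocity_eq[symmetric] add.assoc)
  have pair: "(\<gamma> has_vector_derivative (a, b)) (at t within S) \<longleftrightarrow>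
      ((\<lambda>s. fst (\<gamma> s)) has_vector_derivative a) (at t within S) \<and>
      ((\<lambda>s. snd (\<gamma> s)) has_vector_derivative b) (at t within S)" for a b t S
    using has_vector_derivative_Pair_iff[of "\<lambda>s. fst (\<gamma> s)" "\<lambda>s. snd (\<gamma> s)"] by simp
  show ?thesis
    unfolding hamiltonian_solution_def vel pair state_field_def has_vector_derivative_Pair_iff fst_conv snd_conv
      has_vector_derivative_vec_iff[of p] forall_6
    by (auto simp: momentum_field_def SE3_def mem_Times_iff)
qed

section \<open>Existence and uniqueness of Hamiltonian solutions\<close>

lemma hamiltonian_solution_unique:
  assumes l: "0 \<le> l"
    and 1: "hamiltonian_solution l \<gamma> p" and 2: "hamiltonian_solution l \<delta> q"
    and init: "\<gamma> 0 = \<delta> 0" "p 0 = q 0"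
  shows "\<gamma> l = \<delta> l"
proof -
  have eq: "p t = q t \<and> snd (\<gamma> t) = snd (\<delta> t)" if "t \<in> {0..l}" for t
    using quadratic_ode_unique[OF bounded_bilinear_state_field,
        of l "\<lambda>s. (p s, snd (\<gamma> s))" "\<lambda>s. (q s, snd (\<delta> s))" t] 1 2 init that
    by (auto simp: hamiltonian_solution_iff)
  have "((\<lambda>s. fst (\<gamma> s) - fst (\<delta> s)) has_vector_derivative 0) (at t within {0..l})"
    if t: "t \<in> {0..l}" for t
  proof -
    have "((\<lambda>s. fst (\<gamma> s)) has_vector_derivative p t $ 3 *\<^sub>R (snd (\<gamma> t) *v axis 3 1)) (at t within {0..l})"
      "((\<lambda>s. fst (\<delta> s)) has_vector_derivative q t $ 3 *\<^sub>R (snd (\<delta> t) *v axis 3 1)) (at t within {0..l})"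
      using 1 2 t by (simp_all add: hamiltonian_solution_iff)
    from has_vector_derivative_diff[OF this] show ?thesis using eq[OF t] by simp
  qed
  then obtain c where "\<And>t. t \<in> {0..l} \<Longrightarrow> fst (\<gamma> t) - fst (\<delta> t) = c"
    using has_vector_derivative_zero_constant[of "{0..l}" "\<lambda>t. fst (\<gamma> t) - fst (\<delta> t)"] by auto
  from this[of l] this[of 0] have "fst (\<gamma> l) = fst (\<delta> l)" using l init by simp
  then show ?thesis using eq[of l] l by (simp add: prod_eq_iff)
qed

text \<open>This is the trace of the symmetric \<open>transpose R ** R\<close> times a skew matrix.
  It makes the Frobenius norm of the rotation part a first integral.\<close>

lemma inner_matrix_mult_cross_mat: "inner (R :: real^3^3) (R ** cross_mat a) = 0"
  by (simp add: inner_vec_def sum_3 matrix_matrix_mult_def cross_mat_eq algebra_simps)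

text \<open>Skewness of \<open>cross_mat a\<close> cancels the two terms for every \<open>R\<close>.
  Hence \<open>R ** transpose R\<close> is conserved without knowing orthogonality beforehand; the
  derivative of \<open>transpose R ** R\<close> would only be a commutator.\<close>

lemma gram_derivative_cross_mat:
  fixes R :: "real^3^3"
  shows "R ** transpose (R ** cross_mat a) + (R ** cross_mat a) ** transpose R = 0"
  by (simp add: vec_eq_iff forall_3 matrix_matrix_mult_def transpose_def sum_3 cross_mat_eq
      algebra_simps)

lemma bounded_bilinear_mult_transpose:
  "bounded_bilinear (\<lambda>R S :: real^3^3. R ** transpose S)"
proof -
  have "bilinear (\<lambda>R S :: real^3^3. R ** transpose S)"
    unfolding bilinear_def
    by (auto intro!: linearI simp: vec_eq_iff matrix_matrix_mult_def transpose_def sum_3 algebra_simps)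
  then show ?thesis by (simp add: bilinear_conv_bounded_bilinear)
qed

lemma hamiltonian_solution_exists:
  assumes l: "0 \<le> l"
  obtains \<gamma> p where "hamiltonian_solution l \<gamma> p" "\<gamma> 0 = (0, mat 1)" "p 0 = p0"
proof -
  \<comment> \<open>Both \<open>p1^2 + p2^2 + p3^2\<close> and \<open>p3^2 + p4^2 + p5^2\<close> are
    conserved. Their sum contains \<open>p3^2\<close> twice, whence the extra square;
    \<open>p6^2\<close> and the norm of the rotation part are conserved separately.\<close>
  define W where "W y = inner y y + (fst y $ 3)\<^sup>2" for y :: "(real^6) \<times> (real^3^3)"
  define W' where "W' y h = 2 * inner y h + 2 * (fst y $ 3) * (fst h $ 3)"
    for y h :: "(real^6) \<times> (real^3^3)"
  have dW: "(W has_derivative W' y) (at y)" for y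
    unfolding W_def W'_def
    by (auto intro!: derivative_eq_intros bounded_linear.has_derivative[OF bounded_linear_vec_nth]
        simp: inner_commute algebra_simps fun_eq_iff)
  have W0: "W' y (state_field y y) = 0" for y
    by (simp add: W'_def state_field_def inner_prod_def inner_matrix_mult_cross_mat)
      (simp add: inner_vec_def sum_6 momentum_field_def algebra_simps)
  have W1: "(norm y)\<^sup>2 \<le> W y" for y by (simp add: W_def power2_norm_eq_inner)
  obtain y where y: "y 0 = (p0, mat 1)"
    "\<And>t. t \<in> {0..l} \<Longrightarrow> (y has_vector_derivative state_field (y t) (y t)) (at t within {0..l})"
    using quadratic_ode_exists[OF bounded_bilinear_state_field l dW W0 W1] by metis
  define p where "p t = fst (y t)" for t
  define R where "R t = snd (y t)" for t
  have pR: "y = (\<lambda>t. (p t, R t))" by (simp add: p_def R_def)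
  have dp: "(p has_vector_derivative momentum_field (p t) (p t)) (at t within {0..l})"
    and dR: "(R has_vector_derivative R t ** cross_mat (angular_velocity (p t))) (at t within {0..l})"
    if "t \<in> {0..l}" for t
    using y(2)[OF that] unfolding pR state_field_def has_vector_derivative_Pair_iff by simp_all
  have cont: "continuous_on {0..l} p" "continuous_on {0..l} R"
    by (rule continuous_on_vector_derivative, erule dp dR)+
  have "((\<lambda>t. R t ** transpose (R t)) has_vector_derivative 0) (at t within {0..l})"
    if t: "t \<in> {0..l}" for t
    using bounded_bilinear.has_vector_derivative[OF bounded_bilinear_mult_transpose dR[OF t] dR[OF t]]
    by (simp only: gram_derivative_cross_mat)
  then obtain c where c: "\<And>t. t \<in> {0..l} \<Longrightarrow> R t ** transpose (R t) = c"
    using has_vector_derivative_zero_constant[of "{0..l}" "\<lambda>t. R t ** transpose (R t)"] by auto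
  have "c = mat 1" using c[of 0] l y(1) by (simp add: R_def)
  then have orth: "orthogonal_matrix (R t)" if "t \<in> {0..l}" for t
    using c[OF that] by (simp add: orthogonal_matrix_def matrix_left_right_inverse)
  \<comment> \<open>A continuous function on an interval with values in {1, -1} is constant, so the
    determinant keeps its initial value 1.\<close>
  have "(\<lambda>t. det (R t)) constant_on {0..l}"
  proof (rule continuous_finite_range_constant)
    show "continuous_on {0..l} (\<lambda>t. det (R t))"
      unfolding det_3 by (intro continuous_intros cont)
    have "(\<lambda>t. det (R t)) ` {0..l} \<subseteq> {1, -1}"
      using det_orthogonal_matrix orth by blast
    then show "finite ((\<lambda>t. det (R t)) ` {0..l})" by (rule finite_subset) simp
  qed simp
  then have "det (R t) = det (R 0)" if "t \<in> {0..l}" for t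
    using that l by (auto simp: constant_on_def)
  then have rot: "rotation_matrix (R t)" if "t \<in> {0..l}" for t
    using that orth y(1) by (simp add: rotation_matrix_def R_def)
  define v where "v t = p t $ 3 *\<^sub>R (R t *v axis 3 1)" for t
  have "continuous_on {0..l} v"
    unfolding v_def matrix_vector_mult_def sum_3 by (intro continuous_intros continuous_on_vec_lambda cont)
  then have dx: "((\<lambda>u. integral {0..u} v) has_vector_derivative v t) (at t within {0..l})"
    if "t \<in> {0..l}" for t
    using that by (rule integral_has_vector_derivative)
  show thesis
  proof
    show "hamiltonian_solution l (\<lambda>t. (integral {0..t} v, R t)) p"
      unfolding hamiltonian_solution_iff
      using rot y(2) dx by (auto simp: pR v_def)
    show "(integral {0..0} v, R 0) = (0, mat 1)" using y(1) by (simp add: R_def)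
    show "p 0 = p0" using y(1) by (simp add: p_def)
  qed
qed

text \<open>By uniqueness, any solution at hand evaluates the definite description.\<close>

lemma exp_e_eq:
  assumes "0 \<le> l" "hamiltonian_solution l \<gamma> p" "\<gamma> 0 = \<one>\<^bsub>E3\<^esub>"
  shows "exp_e (p 0) l = \<gamma> l"
  unfolding exp_e_def
  by (rule the_equality) (use assms hamiltonian_solution_unique in metis)+

section \<open>The symmetry\<close>

text \<open>The second column is \<open>det Q\<close> times the first column after a quarter turn.
  This covers rotations and reflections at once and leaves polynomial relations that
  \<open>algebra\<close> can use.\<close>

lemma orthogonal_matrix_2:
  fixes Q :: "real^2^2"
  assumes "orthogonal_matrix Q"
  obtains a b e where "Q$1$1 = a" "Q$2$1 = b" "Q$1$2 = - (e * b)" "Q$2$2 = e * a"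
    "det Q = e" "e\<^sup>2 = 1" "a\<^sup>2 + b\<^sup>2 = 1"
proof -
  have 1: "transpose Q ** Q = mat 1" using assms by (simp add: orthogonal_matrix_def)
  have col: "(Q$1$1)\<^sup>2 + (Q$2$1)\<^sup>2 = 1" and perp: "Q$1$1 * Q$1$2 + Q$2$1 * Q$2$2 = 0"
    using arg_cong[OF 1, of "\<lambda>A. A$1$1"] arg_cong[OF 1, of "\<lambda>A. A$1$2"]
    by (simp_all add: matrix_matrix_mult_def transpose_def sum_2 mat_def power2_eq_square)
  have "(det Q)\<^sup>2 = 1"
    using det_orthogonal_matrix[OF assms] by auto
  moreover have "Q$1$2 = - (det Q * Q$2$1)" "Q$2$2 = det Q * Q$1$1"
    using col perp by (simp_all add: det_2, algebra+)
  ultimately show thesis using that col by blast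
qed

lemma hat_nth [simp]:
  "hat Q $ 1 $ 1 = Q$1$1" "hat Q $ 1 $ 2 = Q$1$2" "hat Q $ 1 $ 3 = 0"
  "hat Q $ 2 $ 1 = Q$2$1" "hat Q $ 2 $ 2 = Q$2$2" "hat Q $ 2 $ 3 = 0"
  "hat Q $ 3 $ 1 = 0" "hat Q $ 3 $ 2 = 0" "hat Q $ 3 $ 3 = 1"
  by (simp_all add: hat_def)

lemma hat_transpose: "hat (transpose Q) = transpose (hat Q)"
  by (simp add: vec_eq_iff forall_3 transpose_def)

lemma hat_mult: "hat (P ** Q) = hat P ** hat Q"
  by (simp add: vec_eq_iff forall_3 matrix_matrix_mult_def sum_2 sum_3)

lemma hat_mat_1: "hat (mat 1) = mat 1"
  by (simp add: vec_eq_iff forall_3 mat_def)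

lemma orthogonal_matrix_hat: "orthogonal_matrix Q \<Longrightarrow> orthogonal_matrix (hat Q)"
  unfolding orthogonal_matrix_def by (metis hat_transpose hat_mult hat_mat_1)

lemma momentum_matrix_mult_nth:
  "(momentum_matrix Q *v p) $ 1 = Q$1$1 * p$1 + Q$1$2 * p$2"
  "(momentum_matrix Q *v p) $ 2 = Q$2$1 * p$1 + Q$2$2 * p$2"
  "(momentum_matrix Q *v p) $ 3 = p$3"
  "(momentum_matrix Q *v p) $ 4 = det Q * Q$1$1 * p$4 + det Q * Q$1$2 * p$5"
  "(momentum_matrix Q *v p) $ 5 = det Q * Q$2$1 * p$4 + det Q * Q$2$2 * p$5"
  "(momentum_matrix Q *v p) $ 6 = p$6"
  by (simp_all add: momentum_matrix_def matrix_vector_mult_def sum_6)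

text \<open>An orthogonal \<open>H\<close> satisfies \<open>H (a x b) = det H (H a x H b)\<close>,
  so conjugating \<open>cross_mat a\<close> by \<open>H\<close> gives \<open>cross_mat\<close> of
  \<open>det H * H a\<close>. For \<open>hat Q\<close> and a horizontal \<open>a\<close> this is the
  block \<open>det Q * Q\<close>.\<close>

lemma cross_mat_momentum_matrix:
  assumes "orthogonal_matrix Q"
  shows "cross_mat (angular_velocity p) ** transpose (hat Q)
    = transpose (hat Q) ** cross_mat (angular_velocity (momentum_matrix Q *v p))"
proof -
  obtain a b e where Q: "Q$1$1 = a" "Q$2$1 = b" "Q$1$2 = - (e * b)" "Q$2$2 = e * a"
    "det Q = e" and e: "e\<^sup>2 = 1" "a\<^sup>2 + b\<^sup>2 = 1"
    using orthogonal_matrix_2[OF assms] by metis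
  show ?thesis
    by (simp add: vec_eq_iff forall_3 matrix_matrix_mult_def transpose_def sum_3 cross_mat_eq
        angular_velocity_def momentum_matrix_mult_nth Q)
      (use e in \<open>intro conjI; algebra\<close>)
qed

text \<open>Let \<open>h = (p1, p2)\<close>, \<open>w = (p4, p5)\<close> and let \<open>J\<close> be
  the quarter turn. For \<open>p6 = 0\<close> the equations read \<open>h' = p3 J w\<close>,
  \<open>w' = - p3 J h\<close>, \<open>p3' = det (h, w)\<close>. Since
  \<open>J Q = det Q * Q J\<close>, they persist under \<open>h\<close> to \<open>Q h\<close> and
  \<open>w\<close> to \<open>det Q * Q w\<close>.\<close>

lemma momentum_field_momentum_matrix:
  assumes "orthogonal_matrix Q" and "p $ 6 = 0"
  shows "momentum_matrix Q *v momentum_field p p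
    = momentum_field (momentum_matrix Q *v p) (momentum_matrix Q *v p)"
proof -
  obtain a b e where Q: "Q$1$1 = a" "Q$2$1 = b" "Q$1$2 = - (e * b)" "Q$2$2 = e * a"
    "det Q = e" and e: "e\<^sup>2 = 1" "a\<^sup>2 + b\<^sup>2 = 1"
    using orthogonal_matrix_2[OF assms(1)] by metis
  show ?thesis
    by (simp add: vec_eq_iff forall_6 momentum_field_def momentum_matrix_mult_nth Q assms(2))
      (use e in \<open>intro conjI; algebra\<close>)
qed

lemma hamiltonian_solution_symmetry:
  assumes Q: "orthogonal_matrix Q" and sol: "hamiltonian_solution l \<gamma> p" and p6: "p 0 $ 6 = 0"
  shows "hamiltonian_solution l
    (\<lambda>t. (hat Q *v fst (\<gamma> t), hat Q ** snd (\<gamma> t) ** transpose (hat Q)))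
    (\<lambda>t. momentum_matrix Q *v p t)"
  unfolding hamiltonian_solution_iff fst_conv snd_conv
proof (intro ballI conjI)
  fix t assume t: "t \<in> {0..l}"
  let ?H = "hat Q" and ?M = "momentum_matrix Q"
  have H: "orthogonal_matrix ?H" using Q by (rule orthogonal_matrix_hat)
  have rot: "rotation_matrix (snd (\<gamma> t))"
    and d: "((\<lambda>s. (p s, snd (\<gamma> s))) has_vector_derivative
      state_field (p t, snd (\<gamma> t)) (p t, snd (\<gamma> t))) (at t within {0..l})"
    and dx: "((\<lambda>s. fst (\<gamma> s)) has_vector_derivative
      p t $ 3 *\<^sub>R (snd (\<gamma> t) *v axis 3 1)) (at t within {0..l})"
    using sol t by (auto simp: hamiltonian_solution_iff)
  \<comment> \<open>The two determinants cancel, so conjugation stays among rotations even when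
    \<open>Q\<close> is a reflection.\<close>
  have "det ?H * det ?H = 1" using det_orthogonal_matrix[OF H] by auto
  then show "rotation_matrix (?H ** snd (\<gamma> t) ** transpose ?H)"
    using rot H by (auto simp: rotation_matrix_def orthogonal_matrix_mul orthogonal_matrix_transpose det_mul)
  \<comment> \<open>The sixth momentum is constant, so its vanishing at time 0 carries over to
    \<open>t\<close>.\<close>
  have "((\<lambda>s. p s $ 6) has_vector_derivative 0) (at s within {0..l})" if "s \<in> {0..l}" for s
    using sol that by (simp add: hamiltonian_solution_def has_real_derivative_iff_has_vector_derivative)
  then obtain c where c: "\<And>s. s \<in> {0..l} \<Longrightarrow> p s $ 6 = c"
    using has_vector_derivative_zero_constant[of "{0..l}" "\<lambda>s. p s $ 6"] by auto
  have p6t: "p t $ 6 = 0" using c[of 0] c[OF t] p6 t by simp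
  have "linear (\<lambda>R. ?H ** R ** transpose ?H)"
    by (intro linearI) (simp_all add: vec_eq_iff matrix_matrix_mult_def sum_3 algebra_simps)
  then have lin: "bounded_linear (\<lambda>R. ?H ** R ** transpose ?H)"
    by (simp add: linear_conv_bounded_linear)
  show "((\<lambda>s. (?M *v p s, ?H ** snd (\<gamma> s) ** transpose ?H)) has_vector_derivative
      state_field (?M *v p t, ?H ** snd (\<gamma> t) ** transpose ?H)
        (?M *v p t, ?H ** snd (\<gamma> t) ** transpose ?H)) (at t within {0..l})"
  proof -
    have "((\<lambda>s. (?M *v p s, ?H ** snd (\<gamma> s) ** transpose ?H)) has_vector_derivative
        (?M *v momentum_field (p t) (p t),
         ?H ** (snd (\<gamma> t) ** cross_mat (angular_velocity (p t))) ** transpose ?H)) (at t within {0..l})"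
      using d unfolding state_field_def has_vector_derivative_Pair_iff fst_conv snd_conv
      by (auto intro: bounded_linear.has_vector_derivative[OF lin]
          bounded_linear.has_vector_derivative[OF matrix_vector_mul_bounded_linear])
    then show ?thesis
      using cross_mat_momentum_matrix[OF Q, of "p t"]
      by (simp add: state_field_def momentum_field_momentum_matrix[OF Q p6t] matrix_mul_assoc[symmetric])
  qed
  \<comment> \<open>The only translational direction of the system is the third axis, which
    \<open>hat Q\<close> fixes, so the right factor does not disturb the position equation.\<close>
  have "transpose ?H *v axis 3 1 = axis 3 1"
    by (simp add: vec_eq_iff forall_3 matrix_vector_mult_def transpose_def sum_3 axis_def)
  then show "((\<lambda>s. ?H *v fst (\<gamma> s)) has_vector_derivative
      (?M *v p t) $ 3 *\<^sub>R (?H ** snd (\<gamma> t) ** transpose ?H *v axis 3 1)) (at t within {0..l})"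
    using bounded_linear.has_vector_derivative[OF matrix_vector_mul_bounded_linear dx, of ?H]
    by (simp add: momentum_matrix_mult_nth matrix_vector_mult_scaleR flip: matrix_vector_mul_assoc)
qed

theorem corollary10:
  fixes Q :: "real^2^2" and p0 :: "real^6" and l :: real
  assumes "orthogonal_matrix Q"
    and "(p0 $ 3)\<^sup>2 + (p0 $ 4)\<^sup>2 + (p0 $ 5)\<^sup>2 = 1"
    and "p0 $ 6 = 0"
    and "0 \<le> l"
  shows "exp_e (p0 v* transpose (momentum_matrix Q)) l =
    (0, hat Q) \<otimes>\<^bsub>E3\<^esub> exp_e p0 l \<otimes>\<^bsub>E3\<^esub> (0, hat (transpose Q))"
proof -
  obtain \<gamma> p where sol: "hamiltonian_solution l \<gamma> p" "\<gamma> 0 = (0, mat 1)" "p 0 = p0"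
    using hamiltonian_solution_exists[OF assms(4)] by metis
  \<comment> \<open>The conjugated curve therefore starts at the identity again, as
    \<open>exp_e\<close> demands.\<close>
  have "hat Q ** transpose (hat Q) = mat 1"
    using orthogonal_matrix_hat[OF assms(1)] by (simp add: orthogonal_matrix_def)
  then have "exp_e (momentum_matrix Q *v p0) l
      = (hat Q *v fst (\<gamma> l), hat Q ** snd (\<gamma> l) ** transpose (hat Q))"
    using exp_e_eq[OF assms(4) hamiltonian_solution_symmetry[OF assms(1) sol(1)]] sol assms(3)
    by (simp add: E3_def)
  moreover have "exp_e p0 l = \<gamma> l"
    using exp_e_eq[OF assms(4) sol(1)] sol by (simp add: E3_def)
  ultimately show ?thesis
    by (simp add: E3_def split_beta hat_transpose)
qed

end
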